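(* The relation $E^{\mathrm{ce}}_{\min}$ is universal.
   Context: Fix a standard (acceptable) enumeration $(\varphi_e)_{e\in\omega}$ of the partial computable functions and let $W_e=\operatorname{dom}(\varphi_e)$. Write $e=^{\mathrm{ce}}e'$ iff $W_e=W_{e'}$. Define $e\mathrel{E^{\mathrm{ce}}_{\min}}e'$ iff $W_e=W_{e'}=\emptyset$, or $W_e,W_{e'}$ are both nonempty and $\min W_e=\min W_{e'}$. An enumeration of a set $A$ is a surjection $\mu:\omega\to A$; $\mu[s]$ denotes the finite string $\mu(0),\dots,\mu(s-1)$. A learner is an arbitrary function $\mathbf{M}:\omega^{<\omega}\to\omega$ (no effectivity is assumed). For an equivalence relation $E^{\mathrm{ce}}$ on $\omega$ extending $=^{\mathrm{ce}}$, a family $\mathfrak{K}$ of nonempty c.e. sets is $E^{\mathrm{ce}}$-learnable if there is a learner $\mathbf{M}$ such that for every $e$ with $W_e\in\mathfrak{K}$ and every enumeration $\mu$ of $W_e$ there is $i\in\omega$ with $i\mathrel{E^{\mathrm{ce}}}e$ and $\mathbf{M}(\mu[s])=i$ for all sufficiently large $s$. $E^{\mathrm{ce}}$ is universal if every family of nonempty c.e. sets is $E^{\mathrm{ce}}$-learnable. *)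

theory Defs
  imports Main
begin

text \<open>
  Codes for Kleene's mu-recursive functions. Codes carry no arity: restricted to argument lists
  of any fixed length k, each code computes some k-ary partial recursive function, which is
  nowhere defined where the arities of its components do not fit together.
\<close>

datatype recf =
    Zero
  | Succ
  | Proj nat
  | Comp recf "recf list"
  | PrimRec recf recf
  | Mu recf

inductive rec_eval :: "recf \<Rightarrow> nat list \<Rightarrow> nat \<Rightarrow> bool" where
  Zero: "rec_eval Zero xs 0"
| Succ: "rec_eval Succ [x] (Suc x)"
| Proj: "i < length xs \<Longrightarrow> rec_eval (Proj i) xs (xs ! i)"
| Comp: "list_all2 (\<lambda>g y. rec_eval g xs y) gs ys \<Longrightarrow> rec_eval f ys z
    \<Longrightarrow> rec_eval (Comp f gs) xs z"
| PrimRec_0: "rec_eval f xs y \<Longrightarrow> rec_eval (PrimRec f g) (0 # xs) y"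
| PrimRec_Suc: "rec_eval (PrimRec f g) (n # xs) y \<Longrightarrow> rec_eval g (n # y # xs) z
    \<Longrightarrow> rec_eval (PrimRec f g) (Suc n # xs) z"
| Mu: "rec_eval f (n # xs) 0 \<Longrightarrow> (\<forall>m<n. \<exists>y. rec_eval f (m # xs) (Suc y))
    \<Longrightarrow> rec_eval (Mu f) xs n"

inductive_cases rec_eval_ZeroE: "rec_eval Zero xs y"
inductive_cases rec_eval_SuccE: "rec_eval Succ xs y"
inductive_cases rec_eval_ProjE: "rec_eval (Proj i) xs y"
inductive_cases rec_eval_CompE: "rec_eval (Comp f gs) xs y"
inductive_cases rec_eval_PrimRec_0E: "rec_eval (PrimRec f g) (0 # xs) y"
inductive_cases rec_eval_PrimRec_SucE: "rec_eval (PrimRec f g) (Suc n # xs) y"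
inductive_cases rec_eval_MuE: "rec_eval (Mu f) xs y"

lemma rec_eval_deterministic:
  "rec_eval c xs y \<Longrightarrow> rec_eval c xs z \<Longrightarrow> y = z"
proof (induction arbitrary: z rule: rec_eval.induct)
  case (Zero xs)
  then show ?case by (rule rec_eval_ZeroE) simp
next
  case (Succ x)
  then show ?case by (rule rec_eval_SuccE) simp
next
  case (Proj i xs)
  from Proj.prems show ?case by (rule rec_eval_ProjE) simp
next
  case (Comp xs gs ys f y)
  from Comp.prems obtain ys' where
    ys': "list_all2 (\<lambda>g y. rec_eval g xs y) gs ys'" "rec_eval f ys' z"
    by (rule rec_eval_CompE)
  have "ys = ys'"
  proof (rule nth_equalityI)
    show "length ys = length ys'"
      using list_all2_lengthD[OF Comp.IH(1)] list_all2_lengthD[OF ys'(1)] by simp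
    fix i assume "i < length ys"
    then have i: "i < length gs" using list_all2_lengthD[OF Comp.IH(1)] by simp
    show "ys ! i = ys' ! i"
      using list_all2_nthD[OF Comp.IH(1) i] list_all2_nthD[OF ys'(1) i] by blast
  qed
  with Comp.IH(2) ys'(2) show ?case by simp
next
  case (PrimRec_0 f xs y g)
  from PrimRec_0.prems have "rec_eval f xs z" by (rule rec_eval_PrimRec_0E)
  then show ?case by (rule PrimRec_0.IH)
next
  case (PrimRec_Suc f g n xs y u)
  from PrimRec_Suc.prems obtain y' where
    y': "rec_eval (PrimRec f g) (n # xs) y'" "rec_eval g (n # y' # xs) z"
    by (rule rec_eval_PrimRec_SucE)
  have "y = y'" by (rule PrimRec_Suc.IH(1)[OF y'(1)])
  then show ?case using PrimRec_Suc.IH(2) y'(2) by simp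
next
  case (Mu f n xs)
  have z: "rec_eval f (z # xs) 0" "\<forall>m<z. \<exists>y. rec_eval f (m # xs) (Suc y)"
    by (rule rec_eval_MuE[OF Mu.prems], assumption)+
  have "\<not> z < n"
  proof
    assume "z < n"
    with Mu.IH(2) obtain y where "\<forall>x. rec_eval f (z # xs) x \<longrightarrow> Suc y = x" by blast
    with z(1) show False by blast
  qed
  moreover have "\<not> n < z"
  proof
    assume "n < z"
    with z(2) obtain y where "rec_eval f (n # xs) (Suc y)" by blast
    from Mu.IH(1)[OF this] show False by simp
  qed
  ultimately show ?case by simp
qed

definition partial_computable :: "(nat \<rightharpoonup> nat) \<Rightarrow> bool" where
  "partial_computable f \<longleftrightarrow> (\<exists>c. \<forall>x y. f x = Some y \<longleftrightarrow> rec_eval c [x] y)"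

definition partial_computable2 :: "(nat \<Rightarrow> nat \<rightharpoonup> nat) \<Rightarrow> bool" where
  "partial_computable2 f \<longleftrightarrow> (\<exists>c. \<forall>e x y. f e x = Some y \<longleftrightarrow> rec_eval c [e, x] y)"

definition total_computable :: "(nat \<Rightarrow> nat) \<Rightarrow> bool" where
  "total_computable f \<longleftrightarrow> partial_computable (\<lambda>x. Some (f x))"

text \<open>
  Acceptability in Rogers' sense: the universal function of the numbering is partial computable
  and the s-m-n property holds.
\<close>

definition acceptable_enumeration :: "(nat \<Rightarrow> nat \<rightharpoonup> nat) \<Rightarrow> bool" where
  "acceptable_enumeration \<phi> \<longleftrightarrow>
     range \<phi> = {f. partial_computable f} \<and>
     partial_computable2 \<phi> \<and>
     (\<forall>\<psi>. partial_computable2 \<psi> \<longrightarrow> (\<exists>h. total_computable h \<and> (\<forall>e. \<phi> (h e) = \<psi> e)))"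

definition W :: "(nat \<Rightarrow> nat \<rightharpoonup> nat) \<Rightarrow> nat \<Rightarrow> nat set" where
  "W \<phi> e = dom (\<phi> e)"

definition eq_ce :: "(nat \<Rightarrow> nat \<rightharpoonup> nat) \<Rightarrow> (nat \<times> nat) set" where
  "eq_ce \<phi> = {(e, e'). W \<phi> e = W \<phi> e'}"

definition E_min_ce :: "(nat \<Rightarrow> nat \<rightharpoonup> nat) \<Rightarrow> (nat \<times> nat) set" where
  "E_min_ce \<phi> = {(e, e').
     W \<phi> e = {} \<and> W \<phi> e' = {} \<or>
     W \<phi> e \<noteq> {} \<and> W \<phi> e' \<noteq> {} \<and> (LEAST x. x \<in> W \<phi> e) = (LEAST x. x \<in> W \<phi> e')}"

definition enumeration_of :: "(nat \<Rightarrow> nat) \<Rightarrow> nat set \<Rightarrow> bool" where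
  "enumeration_of \<mu> A \<longleftrightarrow> range \<mu> = A"

definition initial_segment :: "(nat \<Rightarrow> nat) \<Rightarrow> nat \<Rightarrow> nat list" where
  "initial_segment \<mu> s = map \<mu> [0..<s]"

definition ce_learnable ::
  "(nat \<Rightarrow> nat \<rightharpoonup> nat) \<Rightarrow> (nat \<times> nat) set \<Rightarrow> nat set set \<Rightarrow> bool" where
  "ce_learnable \<phi> E K \<longleftrightarrow>
     (\<exists>M :: nat list \<Rightarrow> nat. \<forall>e \<mu>. W \<phi> e \<in> K \<longrightarrow> enumeration_of \<mu> (W \<phi> e) \<longrightarrow>
        (\<exists>i. (i, e) \<in> E \<and> (\<exists>s0. \<forall>s\<ge>s0. M (initial_segment \<mu> s) = i)))"

text \<open>
  Universality is a notion for equivalence relations extending \<open>eq_ce\<close>; these two standing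
  requirements are part of the definition.
\<close>

definition ce_universal :: "(nat \<Rightarrow> nat \<rightharpoonup> nat) \<Rightarrow> (nat \<times> nat) set \<Rightarrow> bool" where
  "ce_universal \<phi> E \<longleftrightarrow>
     equiv UNIV E \<and> eq_ce \<phi> \<subseteq> E \<and>
     (\<forall>K. (\<forall>A\<in>K. A \<noteq> {} \<and> (\<exists>e. A = W \<phi> e)) \<longrightarrow> ce_learnable \<phi> E K)"

end

theory Submission imports Defs begin

lemma equiv_E_min_ce: "equiv UNIV (E_min_ce \<phi>)"
  by (rule equivI) (auto simp: E_min_ce_def refl_on_def sym_def trans_def)

lemma eq_ce_subset_E_min_ce: "eq_ce \<phi> \<subseteq> E_min_ce \<phi>"
  by (auto simp: eq_ce_def E_min_ce_def)

text \<open>The range of a total function is nonempty, so the least element of \<open>A\<close>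
  appears at some stage. All later segments keep it, and no entry lies below it.\<close>

lemma Min_initial_segment_eventually:
  assumes "enumeration_of \<mu> A"
  shows "\<exists>s0. \<forall>s\<ge>s0. Min (set (initial_segment \<mu> s)) = (LEAST x. x \<in> A)"
proof -
  let ?m = "LEAST x. x \<in> A"
  have A: "range \<mu> = A" using assms by (simp add: enumeration_of_def)
  then have "?m \<in> A" by (metis LeastI rangeI)
  with A obtain t where t: "\<mu> t = ?m" by (metis rangeE)
  \<comment> \<open>A segment of length \<open>s\<close> ends with entry \<open>s - 1\<close>, so
    length \<open>Suc t\<close> is what captures \<open>\<mu> t\<close>.\<close>
  have "Min (set (initial_segment \<mu> s)) = ?m" if "s \<ge> Suc t" for s
  proof (rule Min_eqI)
    show "?m \<le> y" if "y \<in> set (initial_segment \<mu> s)" for y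
      using that A by (auto simp: initial_segment_def intro!: Least_le)
    have "\<mu> t \<in> set (initial_segment \<mu> s)"
      using that by (auto simp: initial_segment_def)
    then show "?m \<in> set (initial_segment \<mu> s)" by (simp only: t)
  qed simp
  then show ?thesis by blast
qed

text \<open>
  The learner conjectures some index of a nonempty set whose minimum is the least number seen so
  far. Early on there may be no such index and the choice is junk, but once the minimum of the
  target has appeared, the target's own index shows that one exists.
\<close>

lemma ce_learnable_E_min_ce:
  assumes "{} \<notin> K"
  shows "ce_learnable \<phi> (E_min_ce \<phi>) K"
proof -
  \<comment> \<open>Learners are arbitrary functions, so a noncomputable choice of index is
    allowed.\<close>
  define index where
    "index m = (SOME i. W \<phi> i \<noteq> {} \<and> (LEAST x. x \<in> W \<phi> i) = m)" for m
  have "\<exists>i. (i, e) \<in> E_min_ce \<phi> \<and>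
      (\<exists>s0. \<forall>s\<ge>s0. index (Min (set (initial_segment \<mu> s))) = i)"
    if e: "W \<phi> e \<in> K" and \<mu>: "enumeration_of \<mu> (W \<phi> e)" for e \<mu>
  \<comment> \<open>The limit conjecture is \<open>index ?m\<close>, which may differ from
    \<open>e\<close>.\<close>
  proof (rule exI, rule conjI)
    let ?m = "LEAST x. x \<in> W \<phi> e"
    have ne: "W \<phi> e \<noteq> {}" using e assms by auto
    moreover have "W \<phi> (index ?m) \<noteq> {} \<and> (LEAST x. x \<in> W \<phi> (index ?m)) = ?m"
      unfolding index_def by (rule someI[of _ e]) (simp add: ne)
    ultimately show "(index ?m, e) \<in> E_min_ce \<phi>" by (simp add: E_min_ce_def)
    show "\<exists>s0. \<forall>s\<ge>s0. index (Min (set (initial_segment \<mu> s))) = index ?m"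
      using Min_initial_segment_eventually[OF \<mu>] by metis
  qed
  then show ?thesis
    \<comment> \<open>On the empty list \<open>Min\<close> is unspecified; this is harmless, as only
      the limit counts.\<close>
    unfolding ce_learnable_def by (intro exI[of _ "\<lambda>xs. index (Min (set xs))"]) blast
qed

theorem proposition5p10:
  fixes \<phi> :: "nat \<Rightarrow> nat \<rightharpoonup> nat"
  assumes "acceptable_enumeration \<phi>"
  shows "ce_universal \<phi> (E_min_ce \<phi>)"
  unfolding ce_universal_def
  using equiv_E_min_ce eq_ce_subset_E_min_ce ce_learnable_E_min_ce by blast

end
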